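(* For every positive integer $N$, $$\mathcal{M}_2(N)=\frac{N^3}{12}-\frac{N}{12}.$$ Moreover, for every integer $m\ge 2$ there exist coefficients $\beta_0(m),\beta_1(m),\dots,\beta_{2m}(m)$, which do not depend on $N$, such that for every positive integer $N$ $$\mathcal{M}_{2m}(N)=\sum_{\nu=0}^{2m}\beta_{2m-\nu}(m)\,N^{1+2m-\nu}.$$
   Context: For $s>0$, positive integers $N$, and $0\le r<1$, define $$\mathcal{M}_s(N;r)=N\sum_{k=1}^{N-1}\Big(1-2r\cos\frac{2\pi k}{N}+r^2\Big)^{-s/2}$$ (an empty sum is $0$). For positive integers $m$ put $\mathcal{M}_{2m}(N)=\lim_{r\to1^-}\mathcal{M}_{2m}(N;r)$. This equals $\mathcal{L}_{2m}(N)=2^{-2m}N\sum_{k=1}^{N-1}\big(\sin\frac{\pi k}{N}\big)^{-2m}$, the Riesz $2m$-energy of the $N$th roots of unity. *)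

theory Defs
  imports Complex_Main
begin

definition M_energy :: "real \<Rightarrow> nat \<Rightarrow> real \<Rightarrow> real" where
  "M_energy s N r =
     real N * (\<Sum>k=1..N-1. (1 - 2 * r * cos (2 * pi * real k / real N) + r\<^sup>2) powr (- s / 2))"

text \<open>\<^term>\<open>M_even m N\<close> is indexed by \<open>m\<close>, not by \<open>2 * m\<close>. The limit is one-sided and always
  exists, by \<open>M_energy_tendsto\<close> below.\<close>

definition M_even :: "nat \<Rightarrow> nat \<Rightarrow> real" where
  "M_even m N = Lim (at_left 1) (\<lambda>r. M_energy (real (2 * m)) N r)"

definition L_even :: "nat \<Rightarrow> nat \<Rightarrow> real" where
  "L_even m N =
     (1 / 2 ^ (2 * m)) * real N * (\<Sum>k=1..N-1. 1 / sin (pi * real k / real N) ^ (2 * m))"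

lemma M_energy_tendsto: "(M_energy (real (2 * m)) N \<longlongrightarrow> L_even m N) (at_left 1)"
proof -
  have summand: "((\<lambda>r. (1 - 2 * r * cos (2 * pi * real k / real N) + r\<^sup>2) powr (- real (2 * m) / 2))
      \<longlongrightarrow> 1 / 2 ^ (2 * m) * (1 / sin (pi * real k / real N) ^ (2 * m))) (at_left 1)"
    if k: "k \<in> {1..N-1}" for k
  proof -
    let ?s = "sin (pi * real k / real N)"
    have kN: "0 < real k" "real k < real N" using k by auto
    have pos: "0 < ?s"
      by (rule sin_gt_zero) (use kN in \<open>auto simp: field_simps\<close>)
    have c: "cos (2 * pi * real k / real N) = 1 - 2 * ?s\<^sup>2"
      using cos_double_sin[of "pi * real k / real N"] by (simp add: mult.assoc)
    have base: "1 - 2 * 1 * cos (2 * pi * real k / real N) + 1\<^sup>2 = (2 * ?s)\<^sup>2"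
      unfolding c by (simp add: power2_eq_square)
    have "((\<lambda>r. (1 - 2 * r * cos (2 * pi * real k / real N) + r\<^sup>2) powr (- real (2 * m) / 2))
      \<longlongrightarrow> (1 - 2 * 1 * cos (2 * pi * real k / real N) + 1\<^sup>2) powr (- real (2 * m) / 2)) (at_left 1)"
      by (intro tendsto_intros) (use base pos in auto)
    moreover have "((2 * ?s)\<^sup>2) powr (- real (2 * m) / 2) = 1 / 2 ^ (2 * m) * (1 / ?s ^ (2 * m))"
    proof -
      have "((2 * ?s)\<^sup>2) powr (- real (2 * m) / 2) = inverse (((2 * ?s)\<^sup>2) powr real m)"
        by (simp add: powr_minus)
      also have "\<dots> = inverse (((2 * ?s)\<^sup>2) ^ m)"
        using pos by (subst powr_realpow) auto
      also have "\<dots> = 1 / 2 ^ (2 * m) * (1 / ?s ^ (2 * m))"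
        by (simp only: power_mult[symmetric] power_mult_distrib[of 2 ?s "2 * m"]) (simp add: field_simps)
      finally show ?thesis .
    qed
    ultimately show ?thesis unfolding base by simp
  qed
  have "((\<lambda>r. real N * (\<Sum>k=1..N-1.
            (1 - 2 * r * cos (2 * pi * real k / real N) + r\<^sup>2) powr (- real (2 * m) / 2)))
      \<longlongrightarrow> real N * (\<Sum>k=1..N-1. 1 / 2 ^ (2 * m) * (1 / sin (pi * real k / real N) ^ (2 * m))))
      (at_left 1)"
    by (intro tendsto_mult tendsto_const tendsto_sum summand)
  then show ?thesis
    unfolding M_energy_def[abs_def] L_even_def sum_distrib_left[symmetric]
    by (simp add: mult_ac)
qed

lemma M_even_eq_L_even: "M_even m N = L_even m N"
  unfolding M_even_def by (rule tendsto_Lim) (simp_all add: M_energy_tendsto[simplified])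

end

(* Put w = cis (2 pi k / N), x = 1 / (1 - w) and y = w / (1 - w). Then x = 1 + y and
   1 / (4 sin^2 (pi k / N)) = - x y, so for m >= 1 the m-th power is a linear combination of the
   terms x y^i with m <= i <= 2m - 1. Let q_i(N) be the sum of x y^i over k = 1, ..., N - 1.
   Evaluating the double sum of (n choose j) w^n over n < N and 1 <= k < N in two ways, by
   summation by parts in n and by orthogonality of the roots of unity, gives the recurrence
   sum_{i<j} (N choose j-i) q_i(N) = (N choose j+1) for j >= 1. As (N choose i+1) / N is a
   polynomial in N of degree i, it follows that q_i(N) is a polynomial in N of degree at most
   i + 1. *)
theory Submission
  imports Defs "HOL-Computational_Algebra.Polynomial"
begin

section \<open>Binomially weighted power sums at a root of unity\<close>

lemma choose_sum_by_parts:
  fixes w :: "'a::comm_ring_1"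
  shows "(\<Sum>n<M. of_nat (n choose Suc j) * w ^ n) * (1 - w) =
    w * (\<Sum>n<M. of_nat (n choose j) * w ^ n) - of_nat (M choose Suc j) * w ^ M"
proof (induction M)
  case (Suc M)
  show ?case
    \<comment> \<open>Pascal's rule cancels the boundary terms at \<open>M\<close> and
      \<open>Suc M\<close> against the new summands.\<close>
    unfolding sum.lessThan_Suc distrib_right Suc.IH by (simp add: algebra_simps)
qed simp

text \<open>As \<open>w ^ N = 1\<close>, dividing the summation by parts by \<open>1 - w\<close>
  gives S_{j+1} = y S_j - (N choose j+1) x, where x = 1 / (1 - w) and y = w / (1 - w). The geometric
  sum S_0 vanishes, and each further step raises the power of y in the older terms by one.\<close>

lemma root_of_unity_choose_sum:
  fixes w :: "'a::field"
  assumes "w ^ N = 1" "w \<noteq> 1"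
  shows "(\<Sum>n<N. of_nat (n choose j) * w ^ n) =
    - (\<Sum>i<j. of_nat (N choose (j - i)) * (1 / (1 - w) * (w / (1 - w)) ^ i))"
proof (induction j)
  case 0
  show ?case using assms by (simp add: sum_gp_strict)
next
  case (Suc j)
  have "(\<Sum>n<N. of_nat (n choose Suc j) * w ^ n) =
      w / (1 - w) * (\<Sum>n<N. of_nat (n choose j) * w ^ n) - of_nat (N choose Suc j) * (1 / (1 - w))"
    using nonzero_eq_divide_eq[THEN iffD2, OF _ choose_sum_by_parts[of j w N]] assms
    by (simp add: diff_divide_distrib)
  also have "\<dots> = - (of_nat (N choose Suc j) * (1 / (1 - w)) + (\<Sum>i<j. of_nat (N choose (j - i)) *
      (1 / (1 - w) * (w / (1 - w)) ^ Suc i)))"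
    unfolding Suc.IH by (simp add: sum_distrib_left mult_ac)
  finally show ?case
    by (subst sum.lessThan_Suc_shift) (simp only: power_0 mult_1_right diff_zero diff_Suc_Suc)
qed

section \<open>Roots of unity and their orthogonality\<close>

definition unity_root :: "nat \<Rightarrow> nat \<Rightarrow> complex" where
  "unity_root N k = cis (2 * pi * real k / real N)"

text \<open>The angle 2 pi k n / N is symmetric in k and n. This turns a sum of n-th powers over all
  roots into a geometric sum with ratio \<open>unity_root N n\<close>.\<close>

lemma unity_root_power_commute: "unity_root N k ^ n = unity_root N n ^ k"
  by (simp add: unity_root_def DeMoivre mult_ac)

lemma unity_root_power_self:
  assumes "0 < N"
  shows "unity_root N k ^ N = 1"
proof -
  have "unity_root N N = 1"
    using assms by (simp add: unity_root_def)
  then show ?thesis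
    by (simp add: unity_root_power_commute[of N k N])
qed

lemma sin_pi_fraction_pos:
  assumes "0 < k" "k < N"
  shows "0 < sin (pi * real k / real N)"
  by (rule sin_gt_zero) (use assms in \<open>auto simp: field_simps\<close>)

lemma cos_unity_angle:
  "cos (2 * pi * real k / real N) = 1 - 2 * (sin (pi * real k / real N))\<^sup>2"
  using cos_double_sin[of "pi * real k / real N"] by (simp add: mult.assoc)

lemma unity_root_neq_1:
  assumes "0 < k" "k < N"
  shows "unity_root N k \<noteq> 1"
  using sin_pi_fraction_pos[OF assms] cos_unity_angle[of k N]
  by (auto simp: unity_root_def complex_eq_iff)

lemma unity_root_orthogonal:
  assumes "0 < n" "n < N"
  shows "(\<Sum>k<N. unity_root N k ^ n) = 0"
  using unity_root_neq_1[OF assms] unity_root_power_self[of N n] assms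
  by (simp add: unity_root_power_commute[of N _ n] sum_gp_strict)

text \<open>With k = 0 included the double sum is 0: orthogonality kills n > 0, and
  \<open>0 choose Suc j\<close> is 0. What remains is minus the k = 0 part, a hockey-stick
  sum.\<close>

lemma unity_root_choose_double_sum:
  "(\<Sum>k=1..<N. \<Sum>n<N. of_nat (n choose Suc j) * unity_root N k ^ n) =
    - of_nat (N choose Suc (Suc j))"
proof (cases "N = 0")
  case False
  have "(\<Sum>k<N. \<Sum>n<N. of_nat (n choose Suc j) * unity_root N k ^ n) =
      (\<Sum>n<N. of_nat (n choose Suc j) * (\<Sum>k<N. unity_root N k ^ n))"
    by (subst sum.swap) (simp add: sum_distrib_left)
  also have "\<dots> = 0"
  proof (rule sum.neutral, rule ballI)
    fix n assume "n \<in> {..<N}"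
    then show "of_nat (n choose Suc j) * (\<Sum>k<N. unity_root N k ^ n) = 0"
      by (cases "n = 0") (simp_all add: unity_root_orthogonal)
  qed
  finally have "(\<Sum>k<N. \<Sum>n<N. of_nat (n choose Suc j) * unity_root N k ^ n) = 0" .
  moreover have "{..<N} = insert 0 {1..<N}" using False by auto
  moreover have "(\<Sum>n<N. of_nat (n choose Suc j) * unity_root N 0 ^ n) =
      of_nat (N choose Suc (Suc j))"
  proof -
    have "(\<Sum>n<M. n choose Suc j) = M choose Suc (Suc j)" for M
      by (induction M) simp_all
    then show ?thesis by (simp add: unity_root_def flip: of_nat_sum)
  qed
  ultimately show ?thesis by (simp add: eq_neg_iff_add_eq_0 add.commute)
qed simp

section \<open>The moments q_i(N) and their polynomial dependence on N\<close>

definition unity_moment :: "nat \<Rightarrow> nat \<Rightarrow> complex" where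
  "unity_moment i N =
    (\<Sum>k=1..<N. 1 / (1 - unity_root N k) * (unity_root N k / (1 - unity_root N k)) ^ i)"

text \<open>The system is triangular: the summand \<open>i = j\<close> has coefficient
  \<open>N choose 1\<close>, so for N \<ge> 1 it determines \<open>unity_moment j N\<close> from the
  lower moments.\<close>

lemma unity_moment_recurrence:
  "(\<Sum>i<Suc j. of_nat (N choose (Suc j - i)) * unity_moment i N) = of_nat (N choose Suc (Suc j))"
proof -
  have "- of_nat (N choose Suc (Suc j)) =
      (\<Sum>k=1..<N. \<Sum>n<N. of_nat (n choose Suc j) * unity_root N k ^ n)"
    by (rule unity_root_choose_double_sum[symmetric])
  also have "\<dots> = (\<Sum>k=1..<N. - (\<Sum>i<Suc j. of_nat (N choose (Suc j - i)) *
      (1 / (1 - unity_root N k) * (unity_root N k / (1 - unity_root N k)) ^ i)))"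
    by (intro sum.cong refl root_of_unity_choose_sum unity_root_power_self unity_root_neq_1) auto
  also have "\<dots> = - (\<Sum>i<Suc j. of_nat (N choose (Suc j - i)) * unity_moment i N)"
    unfolding sum_negf unity_moment_def sum_distrib_left by (subst sum.swap) (rule refl)
  finally show ?thesis by (simp only: neg_equal_iff_equal)
qed

text \<open>The factor N is split off so that it cancels the coefficient N of the top moment in the
  recurrence; otherwise the solution would only be seen to be rational in N.\<close>

lemma choose_Suc_polynomial:
  "\<exists>p :: real poly. degree p \<le> i \<and> (\<forall>N. real (N choose Suc i) = real N * poly p (real N))"
proof (induction i)
  case 0
  show ?case by (intro exI[of _ 1]) simp
next
  case (Suc i)
  then obtain p :: "real poly" where deg: "degree p \<le> i"
    and p: "\<And>N. real (N choose Suc i) = real N * poly p (real N)" by blast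
  define q where "q = smult (1 / real (Suc (Suc i))) ([:- real (Suc i), 1:] * p)"
  have "degree q \<le> degree [:- real (Suc i), 1:] + degree p"
    unfolding q_def by (rule order_trans[OF degree_smult_le degree_mult_le])
  then have "degree q \<le> Suc i" using deg by simp
  moreover have "real (N choose Suc (Suc i)) = real N * poly q (real N)" for N
  proof -
    have "real (Suc (Suc i)) * real (N choose Suc (Suc i)) =
        (real N - real (Suc i)) * real (N choose Suc i)"
    \<comment> \<open>The truncated difference \<open>N - Suc i\<close> agrees with the real one
      only in the first case; in the other, both binomial coefficients are 0.\<close>
    proof (cases "Suc i \<le> N")
      case True
      have "Suc (Suc i) * (N choose Suc (Suc i)) = (N - Suc i) * (N choose Suc i)"
        using binomial_absorb_comp[of N "Suc i"] binomial_absorption[of "Suc i" N] by simp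
      then show ?thesis using True by (metis of_nat_diff of_nat_mult)
    qed (simp add: binomial_eq_0)
    then show ?thesis by (simp add: p q_def field_simps)
  qed
  ultimately show ?case by blast
qed

lemma unity_moment_polynomial:
  "\<exists>p :: real poly. degree p \<le> Suc j \<and>
    (\<forall>N\<ge>1. unity_moment j N = of_real (poly p (real N)))"
proof (induction j rule: less_induct)
  case (less j)
  then obtain p :: "nat \<Rightarrow> real poly" where p: "\<And>i. i < j \<Longrightarrow> degree (p i) \<le> Suc i"
      "\<And>i N. i < j \<Longrightarrow> 1 \<le> N \<Longrightarrow> unity_moment i N = of_real (poly (p i) (real N))"
    by metis
  obtain b :: "nat \<Rightarrow> real poly" where b: "\<And>i. degree (b i) \<le> i"
      "\<And>i N. real (N choose Suc i) = real N * poly (b i) (real N)"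
    using choose_Suc_polynomial by metis
  \<comment> \<open>The recurrence solved for the top moment, with one factor N cancelled from every
    term. The degrees add up to (j - i) + (i + 1) = j + 1.\<close>
  define q where "q = b (Suc j) - (\<Sum>i<j. b (j - i) * p i)"
  have "degree (b (j - i) * p i) \<le> Suc j" if "i < j" for i
    using degree_mult_le[of "b (j - i)" "p i"] b(1)[of "j - i"] p(1)[OF that] that by linarith
  then have "degree q \<le> Suc j"
    unfolding q_def by (intro degree_diff_le degree_sum_le b) auto
  moreover have "unity_moment j N = of_real (poly q (real N))" if N: "1 \<le> N" for N
  proof -
    have bc: "(of_nat (N choose Suc i) :: complex) = of_nat N * of_real (poly (b i) (real N))" for i
      by (metis b(2) of_real_mult of_real_of_nat_eq)
    have "of_nat N * unity_moment j N = of_nat (N choose Suc (Suc j)) -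
        (\<Sum>i<j. of_nat (N choose (Suc (j - i))) * unity_moment i N)"
      using unity_moment_recurrence[of N j] by (simp add: Suc_diff_le algebra_simps)
    also have "\<dots> = of_nat N * of_real (poly q (real N))"
      using p(2) N
      by (simp add: bc q_def poly_sum sum_distrib_left algebra_simps del: binomial_Suc_Suc)
    finally show ?thesis using N by simp
  qed
  ultimately show ?case by blast
qed

section \<open>The energy as a combination of moments\<close>

lemma inverse_sin_squared_eq:
  assumes "0 < k" "k < N"
  defines "w \<equiv> unity_root N k"
  shows "of_real (1 / (4 * (sin (pi * real k / real N))\<^sup>2)) = - (1 / (1 - w) * (w / (1 - w)))"
proof -
  define s where "s = sin (pi * real k / real N)"
  have "w * cnj w = 1"
    by (simp add: w_def unity_root_def cis_cnj cis_mult)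
  moreover have "w + cnj w = of_real (2 * (1 - 2 * s\<^sup>2))"
    by (simp add: w_def unity_root_def s_def complex_eq_iff cos_unity_angle)
  \<comment> \<open>Since \<open>w * cnj w = 1\<close>, the left side is w (w + cnj w - 2).\<close>
  ultimately have "(1 - w) * (1 - w) = - (w * of_real (4 * s\<^sup>2))"
    by simp algebra
  moreover have "s \<noteq> 0" "w \<noteq> 1"
    using sin_pi_fraction_pos[OF assms(1,2)] unity_root_neq_1[OF assms(1,2)]
    by (simp_all add: s_def w_def)
  moreover have "w \<noteq> 0"
    by (simp add: w_def unity_root_def)
  ultimately show ?thesis
    unfolding s_def[symmetric] times_divide_times_eq by simp
qed

lemma L_even_unity_moment:
  "of_real (L_even (Suc m) N) =
    of_nat N * (- 1) ^ Suc m * (\<Sum>l\<le>m. of_nat (m choose l) * unity_moment (Suc m + l) N)"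
proof -
  define x where "x k = 1 / (1 - unity_root N k)" for k
  define y where "y k = unity_root N k / (1 - unity_root N k)" for k
  have summand: "of_real (1 / 2 ^ (2 * Suc m) * (1 / sin (pi * real k / real N) ^ (2 * Suc m))) =
      (- 1) ^ Suc m * (\<Sum>l\<le>m. of_nat (m choose l) * (x k * y k ^ (Suc m + l)))"
    if k: "k \<in> {1..<N}" for k
  proof -
    have "x k = y k + 1"
      using unity_root_neq_1[of k N] k by (simp add: x_def y_def field_simps)
    then have "x k ^ m = (\<Sum>l\<le>m. of_nat (m choose l) * y k ^ l)"
      by (simp add: binomial_ring)
    \<comment> \<open>Only m of the m + 1 factors \<open>x k\<close> are expanded in powers of
      \<open>y k\<close>; the remaining one makes every term a summand of a moment.\<close>
    then have xy: "(x k * y k) ^ Suc m = (\<Sum>l\<le>m. of_nat (m choose l) * (x k * y k ^ (Suc m + l)))"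
      by (simp add: power_mult_distrib sum_distrib_left power_add mult_ac)
    have "1 / 2 ^ (2 * Suc m) * (1 / sin (pi * real k / real N) ^ (2 * Suc m)) =
        (1 / (4 * (sin (pi * real k / real N))\<^sup>2)) ^ Suc m"
      unfolding power_mult by (simp add: power_divide power_mult_distrib)
    also have "of_real \<dots> = (- (x k * y k)) ^ Suc m"
      using k by (simp only: of_real_power inverse_sin_squared_eq x_def y_def
          atLeastLessThan_iff One_nat_def Suc_le_eq)
    also have "\<dots> = (- 1) ^ Suc m * (x k * y k) ^ Suc m"
      by (rule power_minus)
    finally show ?thesis unfolding xy .
  qed
  have "{1..N - 1} = {1..<N}" by auto
  then have "of_real (L_even (Suc m) N) = of_nat N *
      (\<Sum>k=1..<N. of_real (1 / 2 ^ (2 * Suc m) * (1 / sin (pi * real k / real N) ^ (2 * Suc m))))"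
    unfolding L_even_def of_real_sum[symmetric] sum_distrib_left[symmetric]
    by (simp only: of_real_mult of_real_of_nat_eq mult_ac)
  also have "\<dots> = of_nat N * (- 1) ^ Suc m *
      (\<Sum>k=1..<N. \<Sum>l\<le>m. of_nat (m choose l) * (x k * y k ^ (Suc m + l)))"
    using summand by (simp only: sum_distrib_left[symmetric] mult.assoc cong: sum.cong)
  also have "(\<Sum>k=1..<N. \<Sum>l\<le>m. of_nat (m choose l) * (x k * y k ^ (Suc m + l))) =
      (\<Sum>l\<le>m. of_nat (m choose l) * unity_moment (Suc m + l) N)"
    unfolding unity_moment_def x_def y_def by (subst sum.swap) (simp only: sum_distrib_left)
  finally show ?thesis .
qed

lemma L_even_polynomial:
  assumes "1 \<le> m"
  shows "\<exists>p :: real poly. degree p \<le> 2 * m \<and> (\<forall>N\<ge>1. L_even m N = real N * poly p (real N))"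
proof -
  obtain m' where m: "m = Suc m'" using assms by (cases m) auto
  obtain q :: "nat \<Rightarrow> real poly" where q: "\<And>i. degree (q i) \<le> Suc i"
      "\<And>i N. 1 \<le> N \<Longrightarrow> unity_moment i N = of_real (poly (q i) (real N))"
    using unity_moment_polynomial by metis
  define p where "p = smult ((- 1) ^ m) (\<Sum>l\<le>m'. smult (real (m' choose l)) (q (m + l)))"
  \<comment> \<open>The largest moment index is m + m' = 2m - 1, and its polynomial has degree at
    most 2m.\<close>
  have "degree (smult (real (m' choose l)) (q (m + l))) \<le> 2 * m" if "l \<le> m'" for l
    using degree_smult_le[of "real (m' choose l)" "q (m + l)"] q(1)[of "m + l"] that m by linarith
  then have "degree p \<le> 2 * m"
    unfolding p_def by (intro order_trans[OF degree_smult_le] degree_sum_le) auto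
  moreover have "L_even m N = real N * poly p (real N)" if N: "1 \<le> N" for N
  proof -
    have "complex_of_real (L_even m N) = of_real (real N * poly p (real N))"
      unfolding m L_even_unity_moment p_def by (simp add: q(2)[OF N] poly_sum)
    then show ?thesis by (simp only: of_real_eq_iff)
  qed
  ultimately show ?thesis by blast
qed

text \<open>The first two recurrences give q_0 = (N - 1) / 2 and q_1 = -(N^2 - 1) / 12, and the
  energy is -N q_1.\<close>

lemma L_even_1:
  assumes "1 \<le> N"
  shows "L_even 1 N = real N ^ 3 / 12 - real N / 12"
proof -
  have r1: "of_nat N * unity_moment 0 N = of_nat (N choose 2)"
    using unity_moment_recurrence[of N 0] by (simp add: numeral_2_eq_2)
  have r2: "of_nat (N choose 2) * unity_moment 0 N + of_nat N * unity_moment 1 N =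
      of_nat (N choose 3)"
    using unity_moment_recurrence[of N 1] by (simp add: numeral_2_eq_2 numeral_3_eq_3)
  have c2: "2 * (of_nat (N choose 2) :: complex) = of_nat N * (of_nat N - 1)"
    by (induction N) (simp_all add: numeral_2_eq_2 algebra_simps)
  have c3: "6 * (of_nat (N choose 3) :: complex) = of_nat N * (of_nat N - 1) * (of_nat N - 2)"
  proof (induction N)
    case (Suc N)
    have "2 * (of_nat (N choose 2) :: complex) = of_nat N * (of_nat N - 1)"
      by (induction N) (simp_all add: numeral_2_eq_2 algebra_simps)
    moreover have "(of_nat (Suc N choose 3) :: complex) = of_nat (N choose 2) + of_nat (N choose 3)"
      by (simp add: numeral_2_eq_2 numeral_3_eq_3)
    ultimately show ?case using Suc by (simp only: of_nat_Suc) algebra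
  qed simp
  have N0: "(of_nat N :: complex) \<noteq> 0" using assms by simp
  have "2 * unity_moment 0 N = of_nat N - 1"
    using r1 c2 N0 by (metis (no_types, lifting) mult.left_commute mult_cancel_left)
  then have "12 * (of_nat N * unity_moment 1 N) = - (of_nat N * (of_nat N ^ 2 - 1))"
    using r2 c2 c3 by algebra
  moreover have "complex_of_real (L_even 1 N) = - (of_nat N * unity_moment 1 N)"
    using L_even_unity_moment[of 0 N] by simp
  ultimately have "complex_of_real (12 * L_even 1 N) = of_real (real N ^ 3 - real N)"
    by (simp add: algebra_simps power2_eq_square power3_eq_cube)
  then have "12 * L_even 1 N = real N ^ 3 - real N"
    by (simp only: of_real_eq_iff)
  then show ?thesis by simp
qed

theorem theorem4:
  "(\<forall>N::nat. N \<ge> 1 \<longrightarrow> M_even 1 N = real N ^ 3 / 12 - real N / 12) \<and>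
   (\<forall>m::nat. m \<ge> 2 \<longrightarrow>
      (\<exists>\<beta> :: nat \<Rightarrow> real. \<forall>N::nat. N \<ge> 1 \<longrightarrow>
         M_even m N = (\<Sum>\<nu>=0..2*m. \<beta> (2 * m - \<nu>) * real N ^ (1 + 2 * m - \<nu>))))"
proof (intro conjI allI impI)
  show "M_even 1 N = real N ^ 3 / 12 - real N / 12" if "1 \<le> N" for N
    using L_even_1[OF that] by (simp only: M_even_eq_L_even)
next
  fix m :: nat
  assume "2 \<le> m"
  then obtain p :: "real poly" where deg: "degree p \<le> 2 * m"
    and p: "\<And>N. 1 \<le> N \<Longrightarrow> L_even m N = real N * poly p (real N)"
    using L_even_polynomial[of m] by auto
  have "M_even m N = (\<Sum>\<nu>=0..2*m. coeff p (2 * m - \<nu>) * real N ^ (1 + 2 * m - \<nu>))"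
    if N: "1 \<le> N" for N
  proof -
    \<comment> \<open>The degree of p may be below 2m; the missing coefficients are 0.\<close>
    have "poly p (real N) = (\<Sum>i\<le>2 * m. coeff p i * real N ^ i)"
      unfolding poly_altdef using deg
      by (intro sum.mono_neutral_left) (auto simp: coeff_eq_0)
    also have "\<dots> = (\<Sum>\<nu>\<le>2 * m. coeff p (2 * m - \<nu>) * real N ^ (2 * m - \<nu>))"
      by (rule sum.nat_diff_reindex[symmetric, of _ "Suc (2 * m)", simplified lessThan_Suc_atMost, simplified])
    finally have "L_even m N =
        (\<Sum>\<nu>=0..2*m. coeff p (2 * m - \<nu>) * real N ^ Suc (2 * m - \<nu>))"
      by (simp add: p[OF N] sum_distrib_left mult_ac atMost_atLeast0)
    \<comment> \<open>The two exponents agree under truncated subtraction because \<nu> \<le>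
      2m.\<close>
    also have "\<dots> = (\<Sum>\<nu>=0..2*m. coeff p (2 * m - \<nu>) * real N ^ (1 + 2 * m - \<nu>))"
      by (intro sum.cong refl) (simp add: Suc_diff_le)
    finally show ?thesis by (simp only: M_even_eq_L_even)
  qed
  then show "\<exists>\<beta> :: nat \<Rightarrow> real. \<forall>N::nat. N \<ge> 1 \<longrightarrow>
      M_even m N = (\<Sum>\<nu>=0..2*m. \<beta> (2 * m - \<nu>) * real N ^ (1 + 2 * m - \<nu>))"
    by blast
qed

end
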